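(* Let $N,m\ge1$, let $\mathcal C\subset\mathbb H^N$ be a right-$\mathbb H$ submodule of quaternionic dimension $K\ge2$ with orthogonal projector $P\in M_N(\mathbb H)$ (so $P=P^\dagger=P^2$ and $\operatorname{ran}P=\mathcal C$), and let $E_1,\dots,E_m\in M_N(\mathbb H)$ satisfy $\sum_{a=1}^mE_a^\dagger E_a=I_N$. Let $\mathcal N(\rho):=\sum_{a=1}^mE_a\rho E_a^\dagger$ and $Q:=\chi(P)$. The following statements are equivalent: (i) there exists a quaternionic channel $\mathcal R$ on $M_N(\mathbb H)$ that exactly corrects $\mathcal N$ on every state supported on $\mathcal C$, i.e. $\mathcal R(\mathcal N(\rho))=\rho$ for every $\rho\in\mathcal D_N(\mathbb H)$ with $P\rho P=\rho$; (ii) there exists a real positive-semidefinite matrix $r=(r_{ab})\in M_m(\mathbb R)$ such that $PE_a^\dagger E_bP=r_{ab}P$ for all $1\le a,b\le m$; (iii) there exists a positive-semidefinite complex matrix $\lambda=(\lambda_{ab})\in M_m(\mathbb C)$ such that $Q\,\chi(E_a)^\dagger\chi(E_b)\,Q=\lambda_{ab}Q$ for all $1\le a,b\le m$. When these conditions hold, the matrix $r$ is uniquely determined by the error family and the code; it is real symmetric, $\operatorname{Tr}r=1$, and $\operatorname{rank}_{\mathbb R}r$ is the number of nonzero syndrome directions, i.e. for any real orthogonal $O\in M_m(\mathbb R)$ with $OrO^{\mathsf T}=\operatorname{diag}(d_1,\dots,d_m)$, $\operatorname{rank}_{\mathbb R}r$ is the number of indices $\mu$ with $d_\mu>0$, each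 such index giving the syndrome sector defined in the context.
   Context: $\mathbb H$ is the algebra of quaternions with imaginary units $i,j,k=ij$; $\mathbb C$ is identified with $\{a+bi\}\subset\mathbb H$. $\mathbb H^N$ is a right $\mathbb H$-module with inner product $\langle x,y\rangle_{\mathbb H}=\sum_\alpha\overline{x_\alpha}y_\alpha$; matrices in $M_N(\mathbb H)$ act from the left and $A^\dagger=\overline A^{\mathsf T}$. A Hermitian $A=A^\dagger$ satisfies $A\ge0$ when $\langle x,Ax\rangle_{\mathbb H}\ge0$ for all $x\in\mathbb H^N$. The real trace is $\operatorname{Tr}_{\mathbb H}A:=\operatorname{Re}\sum_\alpha A_{\alpha\alpha}$. The state space is $\mathcal D_N(\mathbb H):=\{\rho\in M_N(\mathbb H):\rho=\rho^\dagger,\ \rho\ge0,\ \operatorname{Tr}_{\mathbb H}\rho=1\}$. A quaternionic channel on $M_N(\mathbb H)$ is a map $\rho\mapsto\sum_{r=1}^{n}A_r\rho A_r^\dagger$ with $A_r\in M_N(\mathbb H)$ and $\sum_rA_r^\dagger A_r=I_N$. Every $A\in M_N(\mathbb H)$ is uniquely $A=B+Cj$ with $B,C\in M_N(\mathbb C)$, and $\chi(A):=\begin{pmatrix}B&C\\-\overline C&\overline B\end{pmatrix}\in M_{2N}(\mathbb C)$. Syndrome directions: given a real orthogonal $O$ with $OrO^{\mathsf T}=\operatorname{diag}(d_1,\dots,d_m)$, $d_\mu\ge0$, put $F_\mu:=\sum_aO_{\mu a}E_a$; for each $\mu$ with $d_\mu>0$ put $V_\mu:=d_\mu^{-1/2}F_\mu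 P$ and $Q_\mu:=V_\mu V_\mu^\dagger$. The nonzero syndrome directions are the indices $\mu$ with $d_\mu>0$, with syndrome sectors $\operatorname{ran}Q_\mu$. *)

theory Defs
  imports "HOL-Analysis.Analysis"
begin

text \<open>\<open>Quat a b c d\<close> is $a + bi + cj + dk$.\<close>

datatype quat = Quat (qre: real) (qim_i: real) (qim_j: real) (qim_k: real)

lemma quat_eq_iff:
  "p = q \<longleftrightarrow> qre p = qre q \<and> qim_i p = qim_i q \<and> qim_j p = qim_j q \<and> qim_k p = qim_k q"
  by (cases p; cases q) auto

instantiation quat :: ring_1
begin

definition "0 = Quat 0 0 0 0"
definition "1 = Quat 1 0 0 0"
definition "p + q = Quat (qre p + qre q) (qim_i p + qim_i q) (qim_j p + qim_j q) (qim_k p + qim_k q)"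
definition "p - q = Quat (qre p - qre q) (qim_i p - qim_i q) (qim_j p - qim_j q) (qim_k p - qim_k q)"
definition "- p = Quat (- qre p) (- qim_i p) (- qim_j p) (- qim_k p)"
definition "p * q = Quat
  (qre p * qre q - qim_i p * qim_i q - qim_j p * qim_j q - qim_k p * qim_k q)
  (qre p * qim_i q + qim_i p * qre q + qim_j p * qim_k q - qim_k p * qim_j q)
  (qre p * qim_j q - qim_i p * qim_k q + qim_j p * qre q + qim_k p * qim_i q)
  (qre p * qim_k q + qim_i p * qim_j q - qim_j p * qim_i q + qim_k p * qre q)"

instance
  by standard
    (simp_all add: quat_eq_iff zero_quat_def one_quat_def plus_quat_def minus_quat_def
      uminus_quat_def times_quat_def algebra_simps)

end

instantiation quat :: real_algebra_1
begin

definition "scaleR t q = Quat (t * qre q) (t * qim_i q) (t * qim_j q) (t * qim_k q)"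

instance
  by standard
    (simp_all add: quat_eq_iff plus_quat_def times_quat_def scaleR_quat_def algebra_simps)

end

lemma quat_sel_simps [simp]:
  "qre 0 = 0" "qim_i 0 = 0" "qim_j 0 = 0" "qim_k 0 = 0"
  "qre 1 = 1" "qim_i 1 = 0" "qim_j 1 = 0" "qim_k 1 = 0"
  "qre (p + q) = qre p + qre q" "qim_i (p + q) = qim_i p + qim_i q"
  "qim_j (p + q) = qim_j p + qim_j q" "qim_k (p + q) = qim_k p + qim_k q"
  "qre (p - q) = qre p - qre q" "qim_i (p - q) = qim_i p - qim_i q"
  "qim_j (p - q) = qim_j p - qim_j q" "qim_k (p - q) = qim_k p - qim_k q"
  "qre (- p) = - qre p" "qim_i (- p) = - qim_i p"
  "qim_j (- p) = - qim_j p" "qim_k (- p) = - qim_k p"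
  "qre (t *\<^sub>R p) = t * qre p" "qim_i (t *\<^sub>R p) = t * qim_i p"
  "qim_j (t *\<^sub>R p) = t * qim_j p" "qim_k (t *\<^sub>R p) = t * qim_k p"
  by (simp_all add: zero_quat_def one_quat_def plus_quat_def minus_quat_def uminus_quat_def
      scaleR_quat_def)

instantiation quat :: real_div_algebra
begin

definition "inverse q =
  (1 / ((qre q)\<^sup>2 + (qim_i q)\<^sup>2 + (qim_j q)\<^sup>2 + (qim_k q)\<^sup>2)) *\<^sub>R
    Quat (qre q) (- qim_i q) (- qim_j q) (- qim_k q)"
definition "p div (q :: quat) = p * inverse q"

instance
proof
  fix q :: quat
  let ?n = "(qre q)\<^sup>2 + (qim_i q)\<^sup>2 + (qim_j q)\<^sup>2 + (qim_k q)\<^sup>2"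
  assume "q \<noteq> 0"
  then have "qre q \<noteq> 0 \<or> qim_i q \<noteq> 0 \<or> qim_j q \<noteq> 0 \<or> qim_k q \<noteq> 0"
    by (simp add: quat_eq_iff)
  then have n: "?n > 0"
    by (metis add_nonneg_pos add_pos_nonneg zero_le_power2 zero_less_power2 add_nonneg_nonneg)
  have 1: "q * Quat (qre q) (- qim_i q) (- qim_j q) (- qim_k q) = ?n *\<^sub>R 1"
    "Quat (qre q) (- qim_i q) (- qim_j q) (- qim_k q) * q = ?n *\<^sub>R 1"
    by (simp_all add: quat_eq_iff times_quat_def power2_eq_square)
  show "inverse q * q = 1" "q * inverse q = 1"
    using n by (simp_all only: inverse_quat_def mult_scaleR_left mult_scaleR_right 1) simp_all
next
  show "inverse (0 :: quat) = 0"
    by (simp add: inverse_quat_def)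
qed (rule divide_quat_def)

end

definition qcnj :: "quat \<Rightarrow> quat" where
  "qcnj q = Quat (qre q) (- qim_i q) (- qim_j q) (- qim_k q)"

definition quat_j :: quat where "quat_j = Quat 0 0 1 0"

definition quat_of_complex :: "complex \<Rightarrow> quat" where
  "quat_of_complex z = Quat (Re z) (Im z) 0 0"

definition right_scale :: "quat^'n \<Rightarrow> quat \<Rightarrow> quat^'n" where
  "right_scale x q = (\<chi> i. x $ i * q)"

definition right_submodule :: "(quat^'n) set \<Rightarrow> bool" where
  "right_submodule S \<longleftrightarrow>
    0 \<in> S \<and> (\<forall>x\<in>S. \<forall>y\<in>S. x + y \<in> S) \<and> (\<forall>x\<in>S. \<forall>q. right_scale x q \<in> S)"

definition has_right_dim :: "(quat^'n) set \<Rightarrow> nat \<Rightarrow> bool" where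
  "has_right_dim S K \<longleftrightarrow> (\<exists>B. finite B \<and> card B = K \<and>
    (\<forall>c. (\<Sum>v\<in>B. right_scale v (c v)) = 0 \<longrightarrow> (\<forall>v\<in>B. c v = 0)) \<and>
    S = range (\<lambda>c. \<Sum>v\<in>B. right_scale v (c v)))"

definition qinner :: "quat^'n \<Rightarrow> quat^'n \<Rightarrow> quat" where
  "qinner x y = (\<Sum>i\<in>UNIV. qcnj (x $ i) * y $ i)"

definition qdagger :: "quat^'n^'m \<Rightarrow> quat^'m^'n" where
  "qdagger A = map_matrix qcnj (transpose A)"

definition qpsd :: "quat^'n^'n \<Rightarrow> bool" where
  "qpsd A \<longleftrightarrow> qdagger A = A \<and> (\<forall>x. qinner x (A *v x) \<in> \<real>\<^sub>\<ge>\<^sub>0)"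

definition state_space :: "(quat^'n^'n) set" where
  "state_space = {\<rho>. qpsd \<rho> \<and> qre (trace \<rho>) = 1}"

definition orth_projector :: "quat^'n^'n \<Rightarrow> (quat^'n) set \<Rightarrow> bool" where
  "orth_projector P S \<longleftrightarrow> qdagger P = P \<and> P ** P = P \<and> range ((*v) P) = S"

definition kraus_map :: "'r set \<Rightarrow> ('r \<Rightarrow> quat^'n^'n) \<Rightarrow> quat^'n^'n \<Rightarrow> quat^'n^'n" where
  "kraus_map I A \<rho> = (\<Sum>r\<in>I. A r ** \<rho> ** qdagger (A r))"

definition quat_channel :: "(quat^'n^'n \<Rightarrow> quat^'n^'n) \<Rightarrow> bool" where
  "quat_channel R \<longleftrightarrow> (\<exists>(k::nat) A. R = kraus_map {..<k} A \<and>
    (\<Sum>r<k. qdagger (A r) ** A r) = mat 1)"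

definition complex_part :: "quat \<Rightarrow> complex" where
  "complex_part q = Complex (qre q) (qim_i q)"

definition j_part :: "quat \<Rightarrow> complex" where
  "j_part q = Complex (qim_j q) (qim_k q)"

lemma quat_complex_decomp:
  "q = quat_of_complex b + quat_of_complex c * quat_j \<longleftrightarrow> b = complex_part q \<and> c = j_part q"
  by (auto simp: quat_eq_iff times_quat_def complex_part_def j_part_def quat_j_def
      quat_of_complex_def complex_eq_iff)

text \<open>The block matrix with rows $(B, C)$ and $(-\overline{C}, \overline{B})$ for $A = B + Cj$;
  \<open>Inl\<close> indexes the first block and \<open>Inr\<close> the second.\<close>

definition chi :: "quat^'n^'n \<Rightarrow> complex^('n + 'n)^('n + 'n)" where
  "chi A = (\<chi> s t. case (s, t) of
      (Inl a, Inl b) \<Rightarrow> complex_part (A $ a $ b)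
    | (Inl a, Inr b) \<Rightarrow> j_part (A $ a $ b)
    | (Inr a, Inl b) \<Rightarrow> - cnj (j_part (A $ a $ b))
    | (Inr a, Inr b) \<Rightarrow> cnj (complex_part (A $ a $ b)))"

definition cdagger :: "complex^'n^'m \<Rightarrow> complex^'m^'n" where
  "cdagger A = map_matrix cnj (transpose A)"

definition cpsd :: "complex^'n^'n \<Rightarrow> bool" where
  "cpsd A \<longleftrightarrow> cdagger A = A \<and> (\<forall>x. (\<Sum>i\<in>UNIV. cnj (x $ i) * (A *v x) $ i) \<in> \<real>\<^sub>\<ge>\<^sub>0)"

definition real_psd :: "real^'n^'n \<Rightarrow> bool" where
  "real_psd A \<longleftrightarrow> transpose A = A \<and> (\<forall>x. 0 \<le> x \<bullet> (A *v x))"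

definition exactly_correctable :: "quat^'n^'n \<Rightarrow> ('m::finite \<Rightarrow> quat^'n^'n) \<Rightarrow> bool" where
  "exactly_correctable P E \<longleftrightarrow> (\<exists>R. quat_channel R \<and>
    (\<forall>\<rho>\<in>state_space. P ** \<rho> ** P = \<rho> \<longrightarrow> R (kraus_map UNIV E \<rho>) = \<rho>))"

definition real_KL :: "quat^'n^'n \<Rightarrow> ('m::finite \<Rightarrow> quat^'n^'n) \<Rightarrow> real^'m^'m \<Rightarrow> bool" where
  "real_KL P E r \<longleftrightarrow> real_psd r \<and>
    (\<forall>a b. P ** qdagger (E a) ** E b ** P = (r $ a $ b) *\<^sub>R P)"

definition complex_KL ::
  "complex^'l^'l \<Rightarrow> ('m::finite \<Rightarrow> complex^'l^'l) \<Rightarrow> complex^'m^'m \<Rightarrow> bool" where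
  "complex_KL Q X l \<longleftrightarrow> cpsd l \<and>
    (\<forall>a b. Q ** cdagger (X a) ** X b ** Q = map_matrix ((*) (l $ a $ b)) Q)"

definition diag_matrix :: "real^'m \<Rightarrow> real^'m^'m" where
  "diag_matrix d = (\<chi> i j. if i = j then d $ i else 0)"

definition diagonalizes :: "real^'m^'m \<Rightarrow> real^'m^'m \<Rightarrow> real^'m \<Rightarrow> bool" where
  "diagonalizes U r d \<longleftrightarrow> orthogonal_matrix U \<and> U ** r ** transpose U = diag_matrix d"

definition syndrome_directions :: "real^'m \<Rightarrow> 'm set" where
  "syndrome_directions d = {\<mu>. d $ \<mu> > 0}"

definition syndrome_F ::
  "('m::finite \<Rightarrow> quat^'n^'n) \<Rightarrow> real^'m^'m \<Rightarrow> 'm \<Rightarrow> quat^'n^'n" where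
  "syndrome_F E U \<mu> = (\<Sum>a\<in>UNIV. (U $ \<mu> $ a) *\<^sub>R E a)"

definition syndrome_V ::
  "quat^'n^'n \<Rightarrow> ('m::finite \<Rightarrow> quat^'n^'n) \<Rightarrow> real^'m^'m \<Rightarrow> real^'m \<Rightarrow> 'm \<Rightarrow> quat^'n^'n" where
  "syndrome_V P E U d \<mu> = (1 / sqrt (d $ \<mu>)) *\<^sub>R (syndrome_F E U \<mu> ** P)"

definition syndrome_Q ::
  "quat^'n^'n \<Rightarrow> ('m::finite \<Rightarrow> quat^'n^'n) \<Rightarrow> real^'m^'m \<Rightarrow> real^'m \<Rightarrow> 'm \<Rightarrow> quat^'n^'n" where
  "syndrome_Q P E U d \<mu> = syndrome_V P E U d \<mu> ** qdagger (syndrome_V P E U d \<mu>)"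

definition syndrome_sector ::
  "quat^'n^'n \<Rightarrow> ('m::finite \<Rightarrow> quat^'n^'n) \<Rightarrow> real^'m^'m \<Rightarrow> real^'m \<Rightarrow> 'm \<Rightarrow> (quat^'n) set" where
  "syndrome_sector P E U d \<mu> = range ((*v) (syndrome_Q P E U d \<mu>))"

end

theory Submission
  imports Defs
begin

text \<open>
  All three conditions say that the operators \<open>E a ** P\<close> are real linear combinations of isometries
  of the code onto mutually orthogonal copies of it.

  Correctable errors satisfy the real condition. If a channel with Kraus operators \<open>A l\<close> undoes
  the noise, the operators \<open>A l ** E a\<close> form a Kraus family that fixes every pure state on the code.
  A sum of positive rank-one terms that equals a pure state consists of multiples of that state, so
  each \<open>A l ** E a\<close> maps every quaternionic line of the code into itself
  (\<open>kraus_operators_preserve_line\<close>). On two independent lines the scalars must coincide, because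
  their sum is again mapped into its own line; rescaling one of the two vectors by an arbitrary
  quaternion shows that the common scalar is central, hence real (\<open>real_scalar_on_submodule\<close>).
  This is where dimension at least two enters: on a single line through \<open>x\<close>, each
  quaternion \<open>q\<close> gives the right-linear map that sends \<open>x s\<close> to \<open>x q s\<close>. Thus
  \<open>A l ** E a ** P = m l a *\<^sub>R P\<close> with real \<open>m l a\<close>, and completeness of the \<open>A l\<close> exhibits \<open>r\<close> as the Gram matrix of the columns of \<open>m\<close>.

  The real condition gives a recovery. On the real span of the \<open>E a ** P\<close> the product
  \<open>qdagger Y ** Z\<close> is a real multiple of \<open>P\<close>, so it is a real inner product in disguise, and
  Gram--Schmidt yields a spanning set of isometries with pairwise orthogonal ranges
  (\<open>orthonormal_spanning_set\<close>). Their adjoints, together with the projector onto the complement of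
  all the ranges, are the Kraus operators of the recovery (\<open>exactly_correctable_if_real_KL\<close>). An
  orthonormal set of this kind takes the place of an eigenbasis of \<open>r\<close>, which keeps the spectral
  theorem out of the argument.

  The complex condition is the image of the real one under the injective real *-homomorphism
  \<open>chi\<close>. In the image the lower right block is the conjugate of the upper left one, so a complex
  multiple \<open>z\<close> of \<open>chi P\<close> can lie in it only if \<open>z\<close> is real (\<open>chi_real_multiple\<close>).

  Uniqueness holds because \<open>P \<noteq> 0\<close>, and summing the diagonal conditions gives
  \<open>trace r *\<^sub>R P = P\<close>. Orthogonal conjugation preserves rank, and the
  rank of a nonnegative diagonal matrix counts its positive entries. Finally
  \<open>syndrome_V\<close> satisfies \<open>qdagger V ** V = P\<close>, so \<open>V ** qdagger V\<close> is a nonzero orthogonal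
  projector.
\<close>

section \<open>Quaternionic matrix algebra\<close>

lemma sum_matrix_mult_left: "(\<Sum>a\<in>S. A a) ** B = (\<Sum>a\<in>S. A a ** B)"
  for A :: "_ \<Rightarrow> ('b::semiring_1)^'n^'m"
  unfolding vec_eq_iff by (auto simp: matrix_matrix_mult_def sum_distrib_right intro: sum.swap)

lemma sum_matrix_mult_right: "B ** (\<Sum>a\<in>S. A a) = (\<Sum>a\<in>S. B ** A a)"
  for B :: "('b::semiring_1)^'n^'m"
  unfolding vec_eq_iff by (auto simp: matrix_matrix_mult_def sum_distrib_left intro: sum.swap)

lemma scaleR_matrix_mult_left: "(t *\<^sub>R A) ** B = t *\<^sub>R (A ** B)"
  for A :: "('b::real_algebra_1)^'n^'m"
  unfolding vec_eq_iff by (simp add: matrix_matrix_mult_def scaleR_right.sum)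

lemma scaleR_matrix_mult_right: "A ** (t *\<^sub>R B) = t *\<^sub>R (A ** B)"
  for A :: "('b::real_algebra_1)^'n^'m"
  unfolding vec_eq_iff by (simp add: matrix_matrix_mult_def scaleR_right.sum)

lemma matrix_mult_zero [simp]: "A ** 0 = 0" "0 ** A = 0"
  for A :: "('b::semiring_1)^'n^'n"
  unfolding vec_eq_iff by (simp_all add: matrix_matrix_mult_def)

lemma matrix_add_rdistrib: "(A + B) ** D = A ** D + B ** D"
  for A :: "('b::semiring_1)^'n^'m"
  unfolding vec_eq_iff by (simp add: matrix_matrix_mult_def algebra_simps sum.distrib)

lemma matrix_mult_diff_left: "(A - B) ** D = A ** D - B ** D"
  for A :: "('b::ring_1)^'n^'m"
  unfolding vec_eq_iff by (simp add: matrix_matrix_mult_def algebra_simps sum_subtractf)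

lemma matrix_mult_diff_right: "D ** (A - B) = D ** A - D ** B"
  for D :: "('b::ring_1)^'n^'m"
  unfolding vec_eq_iff by (simp add: matrix_matrix_mult_def algebra_simps sum_subtractf)

lemma qcnj_simps [simp]:
  "qre (qcnj q) = qre q" "qim_i (qcnj q) = - qim_i q"
  "qim_j (qcnj q) = - qim_j q" "qim_k (qcnj q) = - qim_k q"
  by (simp_all add: qcnj_def)

lemma qcnj_algebra:
  "qcnj (p + q) = qcnj p + qcnj q" "qcnj (p - q) = qcnj p - qcnj q"
  "qcnj (p * q) = qcnj q * qcnj p" "qcnj (t *\<^sub>R p) = t *\<^sub>R qcnj p"
  "qcnj (qcnj p) = p" "qcnj 0 = 0" "qcnj 1 = 1"
  by (simp_all add: quat_eq_iff times_quat_def)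

lemma qcnj_sum: "qcnj (\<Sum>a\<in>S. f a) = (\<Sum>a\<in>S. qcnj (f a))"
  by (induction S rule: infinite_finite_induct) (simp_all add: qcnj_algebra)

lemma quat_component_sum:
  "qre (\<Sum>a\<in>S. f a) = (\<Sum>a\<in>S. qre (f a))" "qim_i (\<Sum>a\<in>S. f a) = (\<Sum>a\<in>S. qim_i (f a))"
  "qim_j (\<Sum>a\<in>S. f a) = (\<Sum>a\<in>S. qim_j (f a))" "qim_k (\<Sum>a\<in>S. f a) = (\<Sum>a\<in>S. qim_k (f a))"
  by (induction S rule: infinite_finite_induct) simp_all

definition qnorm2 :: "quat \<Rightarrow> real" where
  "qnorm2 q = (qre q)\<^sup>2 + (qim_i q)\<^sup>2 + (qim_j q)\<^sup>2 + (qim_k q)\<^sup>2"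

lemma qnorm2_nonneg [simp]: "0 \<le> qnorm2 q"
  by (simp add: qnorm2_def)

lemma qnorm2_eq_0 [simp]: "qnorm2 q = 0 \<longleftrightarrow> q = 0"
  by (auto simp: qnorm2_def quat_eq_iff add_nonneg_eq_0_iff)

lemma mult_qcnj: "qcnj q * q = qnorm2 q *\<^sub>R 1" "q * qcnj q = qnorm2 q *\<^sub>R 1"
  by (simp_all add: quat_eq_iff times_quat_def qnorm2_def power2_eq_square)

lemma qdagger_nth [simp]: "qdagger A $ i $ j = qcnj (A $ j $ i)"
  by (simp add: qdagger_def map_matrix_def transpose_def)

lemma qdagger_mult: "qdagger (A ** B) = qdagger B ** qdagger A"
  unfolding vec_eq_iff by (simp add: matrix_matrix_mult_def qcnj_algebra qcnj_sum)

lemma qdagger_algebra: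
  "qdagger (A + B) = qdagger A + qdagger B" "qdagger (A - B) = qdagger A - qdagger B"
  "qdagger (t *\<^sub>R A) = t *\<^sub>R qdagger A" "qdagger (qdagger A) = A" "qdagger 0 = 0"
  "qdagger (mat 1) = mat 1"
  unfolding vec_eq_iff by (simp_all add: qcnj_algebra mat_def)

lemma qdagger_sum: "qdagger (\<Sum>a\<in>S. A a) = (\<Sum>a\<in>S. qdagger (A a))"
  unfolding vec_eq_iff by (simp add: qcnj_sum)

text \<open>The real trace of a Gram matrix is a sum of squares. It vanishes only for the
  zero matrix, and it turns equations between matrices into inequalities between reals.\<close>

lemma qre_trace_gram: "qre (trace (qdagger A ** A)) = (\<Sum>i\<in>UNIV. \<Sum>j\<in>UNIV. qnorm2 (A $ j $ i))"
  for A :: "quat^'n^'n"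
  by (simp add: trace_def matrix_matrix_mult_def mult_qcnj quat_component_sum)

lemma qre_trace_gram_nonneg: "0 \<le> qre (trace (qdagger A ** A))"
  for A :: "quat^'n^'n"
  by (simp add: qre_trace_gram sum_nonneg)

lemma gram_eq_0_iff: "qdagger A ** A = 0 \<longleftrightarrow> A = 0"
  and qre_trace_gram_eq_0_iff: "qre (trace (qdagger A ** A)) = 0 \<longleftrightarrow> A = 0"
  for A :: "quat^'n^'n"
proof -
  show tr: "qre (trace (qdagger A ** A)) = 0 \<longleftrightarrow> A = 0"
    unfolding qre_trace_gram vec_eq_iff by (auto simp: sum_nonneg_eq_0_iff sum_nonneg)
  show "qdagger A ** A = 0 \<longleftrightarrow> A = 0"
    using tr by (auto simp: trace_def)
qed

section \<open>The quaternionic inner product\<close>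

lemma qinner_add_right: "qinner x (y + z) = qinner x y + qinner x z"
  and qinner_diff_right: "qinner x (y - z) = qinner x y - qinner x z"
  and qinner_scaleR_right: "qinner x (t *\<^sub>R y) = t *\<^sub>R qinner x y"
  and qinner_right_scale: "qinner x (right_scale y q) = qinner x y * q"
  and qinner_0_right [simp]: "qinner x 0 = 0"
  by (simp_all add: qinner_def right_scale_def algebra_simps sum.distrib sum_subtractf
      sum_distrib_left sum_distrib_right scaleR_right.sum)

lemma qinner_commute: "qcnj (qinner x y) = qinner y x"
  by (simp add: qinner_def qcnj_sum qcnj_algebra)

lemma qinner_sum_right: "qinner x (\<Sum>a\<in>S. f a) = (\<Sum>a\<in>S. qinner x (f a))"
  by (induction S rule: infinite_finite_induct) (simp_all add: qinner_add_right)

lemma qinner_self: "qinner x x = (\<Sum>i\<in>UNIV. qnorm2 (x $ i)) *\<^sub>R 1"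
  by (simp add: qinner_def mult_qcnj scaleR_left.sum)

lemma qinner_self_eq_0_iff: "qinner x x = 0 \<longleftrightarrow> x = 0"
  unfolding qinner_self vec_eq_iff by (simp add: sum_nonneg_eq_0_iff)

definition qouter :: "quat^'n \<Rightarrow> quat^'n \<Rightarrow> quat^'n^'n" where
  "qouter x y = (\<chi> i j. x $ i * qcnj (y $ j))"

text \<open>Conjugating a rank-one matrix by \<open>A\<close> applies \<open>A\<close> to its vector, which reduces the action of
  a channel on pure states to the action of the Kraus operators on vectors.\<close>

lemma matrix_mult_qouter: "A ** qouter x y ** qdagger B = qouter (A *v x) (B *v y)"
  unfolding vec_eq_iff
  by (simp add: qouter_def matrix_matrix_mult_def matrix_vector_mult_def qcnj_sum qcnj_algebra
      sum_distrib_left sum_distrib_right mult.assoc)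

lemma qouter_vector: "qouter x y *v z = right_scale x (qinner y z)"
  unfolding vec_eq_iff
  by (simp add: qouter_def matrix_vector_mult_def right_scale_def qinner_def
      sum_distrib_left mult.assoc)

lemma qinner_qouter_self: "qinner y (qouter x x *v y) = qnorm2 (qinner y x) *\<^sub>R 1"
  by (metis qouter_vector qinner_right_scale qinner_commute mult_qcnj(2))

lemma qdagger_qouter: "qdagger (qouter x y) = qouter y x"
  unfolding vec_eq_iff by (simp add: qouter_def qcnj_algebra)

lemma qre_trace_qouter: "qre (trace (qouter x x)) = (\<Sum>i\<in>UNIV. qnorm2 (x $ i))"
  by (simp add: trace_def qouter_def mult_qcnj quat_component_sum)

lemma scaleR_matrix_vector: "(t *\<^sub>R A) *v x = t *\<^sub>R (A *v x)"
  for A :: "('b::real_algebra_1)^'n^'m"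
  unfolding vec_eq_iff by (simp add: matrix_vector_mult_def scaleR_right.sum)

lemma sum_matrix_vector: "(\<Sum>a\<in>S. A a) *v x = (\<Sum>a\<in>S. A a *v x)"
  for A :: "_ \<Rightarrow> ('b::semiring_1)^'n^'m"
  unfolding vec_eq_iff by (auto simp: matrix_vector_mult_def sum_distrib_right intro: sum.swap)

lemma matrix_vector_right_scale: "A *v right_scale x q = right_scale (A *v x) q"
  unfolding vec_eq_iff
  by (simp add: matrix_vector_mult_def right_scale_def sum_distrib_right mult.assoc)

lemma matrix_eqI_vector: "(\<And>x. A *v x = B *v x) \<Longrightarrow> A = B"
  for A :: "quat^'n^'m"
  by (simp add: matrix_eq)

lemma right_scale_simps:
  "right_scale (x + y) q = right_scale x q + right_scale y q"
  "right_scale x (p + q) = right_scale x p + right_scale x q"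
  "right_scale (right_scale x p) q = right_scale x (p * q)"
  "right_scale x 1 = x" "right_scale x 0 = 0" "right_scale 0 q = 0"
  "right_scale x (t *\<^sub>R q) = t *\<^sub>R right_scale x q"
  "right_scale (t *\<^sub>R x) q = t *\<^sub>R right_scale x q"
  "right_scale x (- q) = - right_scale x q"
  unfolding vec_eq_iff by (simp_all add: right_scale_def algebra_simps)

section \<open>Recovery from the real Knill--Laflamme condition\<close>

text \<open>Channels are defined with Kraus operators numbered by natural numbers; any finite index set
  serves equally well after an enumeration. The recovery below is indexed by an option type, with \<open>None\<close> for
  the complement of the error ranges.\<close>

lemma quat_channelI:
  assumes "finite I" and "(\<Sum>r\<in>I. qdagger (A r) ** A r) = mat 1"
  shows "quat_channel (kraus_map I A)"
proof -
  obtain h where h: "bij_betw h {0..<card I} I"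
    using ex_bij_betw_nat_finite[OF assms(1)] by blast
  then have h: "bij_betw h {..<card I} I"
    by (simp add: lessThan_atLeast0)
  have "kraus_map I A = kraus_map {..<card I} (A \<circ> h)"
    by (intro ext)
      (simp add: kraus_map_def sum.reindex_bij_betw[OF h, of "\<lambda>r. A r ** _ ** qdagger (A r)"])
  moreover have "(\<Sum>r<card I. qdagger ((A \<circ> h) r) ** (A \<circ> h) r) = mat 1"
    using assms(2) by (simp add: sum.reindex_bij_betw[OF h, of "\<lambda>r. qdagger (A r) ** A r"])
  ultimately show ?thesis
    unfolding quat_channel_def by blast
qed

text \<open>The product \<open>qdagger Y ** Z\<close> is bilinear over the reals, so being a real multiple of \<open>P\<close>
  passes from a set to its real span in each argument separately.\<close>

lemma gram_multiple_span:
  fixes P :: "quat^'n^'n" and S :: "(quat^'n^'n) set"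
  assumes gram: "\<And>Y Z. Y \<in> S \<Longrightarrow> Z \<in> S \<Longrightarrow> \<exists>t. qdagger Y ** Z = t *\<^sub>R P"
    and "Y \<in> span S" "Z \<in> span S"
  shows "\<exists>t. qdagger Y ** Z = t *\<^sub>R P"
proof -
  have right: "\<exists>t. qdagger Y ** Z = t *\<^sub>R P" if Y: "Y \<in> S" and Z: "Z \<in> span S" for Y Z
    using Z
  proof (induction rule: span_induct_alt)
    case base
    show ?case by (intro exI[of _ 0]) simp
  next
    case (step c x y)
    then obtain t u where "qdagger Y ** x = t *\<^sub>R P" "qdagger Y ** y = u *\<^sub>R P"
      using gram[OF Y] by metis
    then have "qdagger Y ** (c *\<^sub>R x + y) = (c * t + u) *\<^sub>R P"
      by (simp add: matrix_add_ldistrib scaleR_matrix_mult_right scaleR_add_left)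
    then show ?case ..
  qed
  show ?thesis
    using assms(2)
  proof (induction rule: span_induct_alt)
    case base
    show ?case by (intro exI[of _ 0]) (simp add: qdagger_algebra)
  next
    case (step c x y)
    then obtain t u where "qdagger x ** Z = t *\<^sub>R P" "qdagger y ** Z = u *\<^sub>R P"
      using right[OF _ assms(3)] by metis
    then have "qdagger (c *\<^sub>R x + y) ** Z = (c * t + u) *\<^sub>R P"
      by (simp add: qdagger_algebra matrix_add_rdistrib scaleR_matrix_mult_left scaleR_add_left)
    then show ?case ..
  qed
qed

text \<open>When \<open>P\<close> is an orthogonal projector, these are partial isometries with initial space the range
  of \<open>P\<close> and pairwise orthogonal final spaces; equivalently, an orthonormal set for the
  \<open>P\<close>-valued product \<open>qdagger Y ** Z\<close>.\<close>

definition isometry_family :: "quat^'n^'n \<Rightarrow> (quat^'n^'n) set \<Rightarrow> bool" where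
  "isometry_family P B \<longleftrightarrow> (\<forall>Y\<in>B. \<forall>Z\<in>B. qdagger Y ** Z = (if Y = Z then P else 0))"

lemma isometry_familyD:
  "isometry_family P B \<Longrightarrow> Y \<in> B \<Longrightarrow> Z \<in> B \<Longrightarrow> qdagger Y ** Z = (if Y = Z then P else 0)"
  by (simp add: isometry_family_def)

text \<open>Gram--Schmidt for the \<open>P\<close>-valued product. A new element \<open>x\<close> leaves the remainder \<open>X\<close> after
  subtraction of its components along the current family. Either \<open>X = 0\<close>, or
  \<open>qdagger X ** X = t *\<^sub>R P\<close> has \<open>t > 0\<close>, because the left side has positive real trace and \<open>P\<close> a
  nonnegative one; then \<open>X\<close> divided by \<open>sqrt t\<close> joins the family.\<close>

lemma orthonormal_spanning_set:
  fixes P :: "quat^'n^'n" and S :: "(quat^'n^'n) set"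
  assumes P: "qdagger P = P" "P ** P = P"
    and "finite S"
    and gram: "\<And>Y Z. Y \<in> S \<Longrightarrow> Z \<in> S \<Longrightarrow> \<exists>t. qdagger Y ** Z = t *\<^sub>R P"
  shows "\<exists>B. finite B \<and> B \<subseteq> span S \<and> S \<subseteq> span B \<and> isometry_family P B"
  using assms(3,4)
proof (induction S rule: finite_induct)
  case empty
  show ?case by (intro exI[of _ "{}"]) (auto simp: isometry_family_def)
next
  case (insert x S)
  then obtain B where B: "finite B" "B \<subseteq> span S" "S \<subseteq> span B"
    and isom: "isometry_family P B"
    using insert.IH by blast
  note orth = isometry_familyD[OF isom]
  let ?T = "span (insert x S)"
  have BT: "B \<subseteq> ?T"
    using B(2) span_mono[of S "insert x S"] by blast
  have multiple: "\<exists>t. qdagger Y ** Z = t *\<^sub>R P" if "Y \<in> ?T" "Z \<in> ?T" for Y Z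
    using gram_multiple_span[OF insert.prems that] .
  have xT: "x \<in> ?T"
    by (simp add: span_base)
  have "\<forall>Y\<in>B. \<exists>t. qdagger Y ** x = t *\<^sub>R P"
    using multiple BT xT by blast
  then obtain c where c: "\<And>Y. Y \<in> B \<Longrightarrow> qdagger Y ** x = c Y *\<^sub>R P"
    by metis
  define X where "X = x - (\<Sum>Y\<in>B. c Y *\<^sub>R Y)"
  have XT: "X \<in> ?T"
    unfolding X_def using BT xT by (intro span_diff span_sum span_scale) auto
  have x_eq: "x = X + (\<Sum>Y\<in>B. c Y *\<^sub>R Y)"
    by (simp add: X_def)
  have sumB: "(\<Sum>Y\<in>B. c Y *\<^sub>R Y) \<in> span B"
    by (intro span_sum span_scale span_base)
  have X_orth: "qdagger Y ** X = 0" if Y: "Y \<in> B" for Y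
  proof -
    have "qdagger Y ** (\<Sum>Z\<in>B. c Z *\<^sub>R Z) = (\<Sum>Z\<in>B. if Z = Y then c Y *\<^sub>R P else 0)"
      unfolding sum_matrix_mult_right scaleR_matrix_mult_right
      by (intro sum.cong) (auto simp: orth[OF Y])
    then show ?thesis
      using Y B(1) by (simp add: X_def matrix_mult_diff_right c)
  qed
  show ?case
  proof (cases "X = 0")
    case True
    then have "insert x S \<subseteq> span B"
      using x_eq sumB B(3) by simp
    then show ?thesis
      using B(1) BT isom by blast
  next
    case False
    obtain t where t: "qdagger X ** X = t *\<^sub>R P"
      using multiple XT by blast
    have "0 < qre (trace (qdagger X ** X))"
      using False qre_trace_gram_nonneg[of X] qre_trace_gram_eq_0_iff[of X] by linarith
    also have "\<dots> = t * qre (trace (qdagger P ** P))"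
      by (simp add: t P trace_def quat_component_sum sum_distrib_left)
    finally have "t > 0"
      using qre_trace_gram_nonneg[of P] by (simp add: zero_less_mult_iff)
    define V where "V = (1 / sqrt t) *\<^sub>R X"
    have VV: "qdagger V ** V = P"
      using \<open>t > 0\<close>
      by (simp add: V_def qdagger_algebra scaleR_matrix_mult_left scaleR_matrix_mult_right t)
    have YV: "qdagger Y ** V = 0" if "Y \<in> B" for Y
      using X_orth[OF that] by (simp add: V_def scaleR_matrix_mult_right)
    have VY: "qdagger V ** Y = 0" if "Y \<in> B" for Y
      using arg_cong[OF YV[OF that], of qdagger] by (simp add: qdagger_mult qdagger_algebra)
    have "V \<noteq> 0"
      using False \<open>t > 0\<close> by (simp add: V_def)
    then have "V \<notin> B"
      using YV gram_eq_0_iff by blast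
    have "X = sqrt t *\<^sub>R V"
      using \<open>t > 0\<close> by (simp add: V_def)
    moreover have "V \<in> span (insert V B)"
      by (simp add: span_base)
    moreover have "(\<Sum>Y\<in>B. c Y *\<^sub>R Y) \<in> span (insert V B)"
      using sumB span_mono[of B "insert V B"] by blast
    ultimately have "x \<in> span (insert V B)"
      by (subst x_eq, subst \<open>X = sqrt t *\<^sub>R V\<close>) (intro span_add span_scale)
    moreover have "S \<subseteq> span (insert V B)"
      using B(3) span_mono[of B "insert V B"] by blast
    moreover have "V \<in> ?T"
      unfolding V_def by (intro span_scale XT)
    moreover have "isometry_family P (insert V B)"
      unfolding isometry_family_def using orth VV YV VY \<open>V \<notin> B\<close> by auto
    ultimately show ?thesis
      using B(1) BT by (intro exI[of _ "insert V B"]) auto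
  qed
qed

text \<open>With \<open>E a ** P = (\<Sum>Y\<in>B. c a Y *\<^sub>R Y)\<close> for an isometry family \<open>B\<close>, measuring which range the
  error has reached and undoing the isometry \<open>Y\<close> returns \<open>(c a Y)\<^sup>2 *\<^sub>R \<rho>\<close>. The weights do not depend
  on \<open>\<rho>\<close>, and completeness of the errors makes their sum act as one on the code.\<close>

lemma exactly_correctable_if_real_KL:
  fixes P :: "quat^'n^'n" and E :: "'m::finite \<Rightarrow> quat^'n^'n"
  assumes P: "qdagger P = P" "P ** P = P"
    and E: "(\<Sum>a\<in>UNIV. qdagger (E a) ** E a) = mat 1"
    and KL: "\<And>a b. P ** qdagger (E a) ** E b ** P = r a b *\<^sub>R P"
  shows "exactly_correctable P E"
proof -
  define X where "X a = E a ** P" for a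
  have XX: "qdagger (X a) ** X b = r a b *\<^sub>R P" for a b
    by (simp add: X_def qdagger_mult P matrix_mul_assoc KL)
  have XP: "X a ** P = X a" for a
    by (simp add: X_def matrix_mul_assoc[symmetric] P)
  have "\<exists>B. finite B \<and> B \<subseteq> span (range X) \<and> range X \<subseteq> span B \<and> isometry_family P B"
    by (rule orthonormal_spanning_set[OF P]) (use XX in auto)
  then obtain B where B: "finite B" "B \<subseteq> span (range X)" "range X \<subseteq> span B"
    and isom: "isometry_family P B"
    by blast
  note orth = isometry_familyD[OF isom]
  have spanP: "Y ** P = Y" if "Y \<in> span (range X)" for Y
    using that
    by (induction rule: span_induct_alt)
      (auto simp: matrix_add_rdistrib scaleR_matrix_mult_left XP)
  have BP: "Y ** P = Y" if "Y \<in> B" for Y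
    using spanP B(2) that by blast
  have "\<exists>c. X a = (\<Sum>Y\<in>B. c Y *\<^sub>R Y)" for a
    using B(1,3) span_finite[OF B(1)] by blast
  then obtain c where c: "\<And>a. X a = (\<Sum>Y\<in>B. c a Y *\<^sub>R Y)"
    by metis
  have YX: "qdagger Y ** X a = c a Y *\<^sub>R P" if Y: "Y \<in> B" for Y a
  proof -
    have "qdagger Y ** X a = (\<Sum>Z\<in>B. if Z = Y then c a Y *\<^sub>R P else 0)"
      unfolding c sum_matrix_mult_right scaleR_matrix_mult_right
      by (intro sum.cong) (auto simp: orth[OF Y])
    then show ?thesis
      using Y B(1) by simp
  qed
  have XY: "qdagger (X a) ** Y = c a Y *\<^sub>R P" if Y: "Y \<in> B" for Y a
    using arg_cong[OF YX[OF Y, of a], of qdagger] by (simp add: qdagger_mult qdagger_algebra P)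
  \<comment> \<open>The total weight with which the recovery will return the state.\<close>
  define s where "s = (\<Sum>Y\<in>B. \<Sum>a\<in>UNIV. (c a Y)\<^sup>2)"
  have "s *\<^sub>R P = (\<Sum>a\<in>UNIV. qdagger (X a) ** X a)"
  proof -
    have "qdagger (X a) ** X a = (\<Sum>Y\<in>B. (c a Y)\<^sup>2 *\<^sub>R P)" for a
      by (subst (2) c) (simp add: sum_matrix_mult_right scaleR_matrix_mult_right XY power2_eq_square)
    then show ?thesis
      by (simp add: s_def scaleR_left.sum sum.swap[of _ B])
  qed
  also have "\<dots> = P ** (\<Sum>a\<in>UNIV. qdagger (E a) ** E a) ** P"
    by (simp add: X_def qdagger_mult P sum_matrix_mult_right sum_matrix_mult_left matrix_mul_assoc)
  also have "\<dots> = P"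
    by (simp add: E P)
  finally have sP: "s *\<^sub>R P = P" .
  \<comment> \<open>\<open>G\<close> projects onto the sum of all error ranges. The operator \<open>mat 1 - G\<close> completes the family
    to a channel and vanishes on every corrupted code state.\<close>
  define G where "G = (\<Sum>Y\<in>B. Y ** qdagger Y)"
  have G_dag: "qdagger G = G"
    by (simp add: G_def qdagger_sum qdagger_mult qdagger_algebra)
  have GY: "G ** Y = Y" if Y: "Y \<in> B" for Y
  proof -
    have "G ** Y = (\<Sum>Z\<in>B. if Z = Y then Y else 0)"
      unfolding G_def sum_matrix_mult_left matrix_mul_assoc[symmetric]
      by (intro sum.cong) (auto simp: orth[OF _ Y] BP[OF Y])
    then show ?thesis
      using Y B(1) by simp
  qed
  have GG: "G ** G = G"
    by (subst (2 3) G_def) (simp add: sum_matrix_mult_right matrix_mul_assoc GY)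
  have GX: "G ** X a = X a" for a
    by (subst (1 2) c) (simp add: sum_matrix_mult_right scaleR_matrix_mult_right GY)
  define I where "I = insert None (Some ` B)"
  define A where "A = case_option (mat 1 - G) qdagger"
  have I_sum: "(\<Sum>i\<in>I. f i) = f None + (\<Sum>Y\<in>B. f (Some Y))" for f :: "_ \<Rightarrow> quat^'n^'n"
    using B(1) by (simp add: I_def sum.reindex)
  have "(\<Sum>i\<in>I. qdagger (A i) ** A i) = mat 1"
    by (simp add: I_sum A_def qdagger_algebra G_dag matrix_mult_diff_left matrix_mult_diff_right GG)
      (simp add: G_def)
  then have channel: "quat_channel (kraus_map I A)"
    using B(1) by (intro quat_channelI) (simp_all add: I_def)
  have recovers: "kraus_map I A (kraus_map UNIV E \<rho>) = \<rho>" if \<rho>: "P ** \<rho> ** P = \<rho>" for \<rho>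
  proof -
    have noise: "E a ** \<rho> ** qdagger (E a) = X a ** \<rho> ** qdagger (X a)" for a
    proof -
      have "X a ** \<rho> ** qdagger (X a) = E a ** (P ** \<rho> ** P) ** qdagger (E a)"
        by (simp add: X_def qdagger_mult P matrix_mul_assoc)
      then show ?thesis
        by (simp add: \<rho>)
    qed
    have "A None ** X a = 0" for a
      by (simp add: A_def matrix_mult_diff_left GX)
    then have none: "A None ** (X a ** \<rho> ** qdagger (X a)) ** qdagger (A None) = 0" for a
      by (simp add: matrix_mul_assoc)
    have some: "A (Some Y) ** (X a ** \<rho> ** qdagger (X a)) ** qdagger (A (Some Y)) = (c a Y)\<^sup>2 *\<^sub>R \<rho>"
      if Y: "Y \<in> B" for a Y
    proof -
      have "A (Some Y) ** (X a ** \<rho> ** qdagger (X a)) ** qdagger (A (Some Y))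
          = (qdagger Y ** X a) ** \<rho> ** (qdagger (X a) ** Y)"
        by (simp add: A_def qdagger_algebra matrix_mul_assoc)
      also have "\<dots> = (c a Y)\<^sup>2 *\<^sub>R (P ** \<rho> ** P)"
        by (simp add: YX XY Y scaleR_matrix_mult_left scaleR_matrix_mult_right power2_eq_square)
      finally show ?thesis
        by (simp add: \<rho>)
    qed
    have "kraus_map I A (kraus_map UNIV E \<rho>) = (\<Sum>Y\<in>B. \<Sum>a\<in>UNIV. (c a Y)\<^sup>2 *\<^sub>R \<rho>)"
      by (simp add: kraus_map_def I_sum noise sum_matrix_mult_left sum_matrix_mult_right none some)
    also have "\<dots> = s *\<^sub>R (P ** \<rho> ** P)"
      by (simp add: s_def scaleR_left.sum \<rho>)
    also have "\<dots> = (s *\<^sub>R P) ** \<rho> ** P"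
      by (simp add: scaleR_matrix_mult_left)
    finally show ?thesis
      by (simp add: sP \<rho>)
  qed
  show ?thesis
    unfolding exactly_correctable_def using channel recovers by blast
qed

section \<open>Exact correctability forces real scalars\<close>

lemma quat_central_real:
  assumes "\<And>s :: quat. p * s = s * p"
  shows "p = qre p *\<^sub>R 1"
  using assms[of "Quat 0 1 0 0"] assms[of "Quat 0 0 1 0"]
  by (simp add: quat_eq_iff times_quat_def)

text \<open>Let \<open>M x = x p\<close> and \<open>M y = y q\<close>. For each quaternion \<open>s\<close> the vector \<open>x s + y\<close> is also mapped
  into its own line, say by \<open>r\<close>; comparing coefficients gives \<open>r = q\<close> and \<open>p s = s q\<close>. The choice
  \<open>s = 1\<close> gives \<open>p = q\<close>, and then \<open>p\<close> commutes with every quaternion.\<close>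

lemma independent_common_real_eigenvalue:
  assumes C: "right_submodule C" and xy: "x \<in> C" "y \<in> C"
    and indep: "\<And>a b. right_scale x a + right_scale y b = 0 \<Longrightarrow> a = 0 \<and> b = 0"
    and line: "\<And>z. z \<in> C \<Longrightarrow> \<exists>q. M *v z = right_scale z q"
  shows "\<exists>t. M *v x = t *\<^sub>R x \<and> M *v y = t *\<^sub>R y"
proof -
  obtain p q where p: "M *v x = right_scale x p" and q: "M *v y = right_scale y q"
    using line xy by meson
  have pq: "p * s = s * q" for s
  proof -
    have "right_scale x s + y \<in> C"
      using C xy by (simp add: right_submodule_def)
    then obtain r where "M *v (right_scale x s + y) = right_scale (right_scale x s + y) r"
      using line by blast
    then have "right_scale x (p * s) + right_scale y q = right_scale x (s * r) + right_scale y r"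
      by (simp add: matrix_vector_right_distrib matrix_vector_right_scale p q right_scale_simps)
    then have "right_scale x (p * s + - (s * r)) + right_scale y (q + - r) = 0"
      by (simp only: right_scale_simps) (simp add: algebra_simps)
    from indep[OF this] show ?thesis
      by simp
  qed
  from pq[of 1] have "p = q"
    by simp
  with pq have "p = qre p *\<^sub>R 1"
    by (intro quat_central_real) simp
  then obtain t where t: "p = t *\<^sub>R 1"
    by blast
  have "right_scale z p = t *\<^sub>R z" for z :: "quat^'a"
    by (simp add: t right_scale_simps)
  then show ?thesis
    using p q \<open>p = q\<close> by metis
qed

text \<open>A vector of the submodule is either independent of \<open>v\<close>, and then shares the real scalar of \<open>v\<close>,
  or a right multiple of \<open>v\<close>, and then inherits that scalar because reals commute past the right
  factor. The vector \<open>w\<close> serves to make the scalar of \<open>v\<close> real in the first place.\<close>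

lemma real_scalar_on_submodule:
  assumes C: "right_submodule C" and vw: "v \<in> C" "w \<in> C"
    and indep: "\<And>a b. right_scale v a + right_scale w b = 0 \<Longrightarrow> a = 0 \<and> b = 0"
    and line: "\<And>z. z \<in> C \<Longrightarrow> \<exists>q. M *v z = right_scale z q"
  shows "\<exists>t. \<forall>x\<in>C. M *v x = t *\<^sub>R x"
proof -
  obtain t where t: "M *v v = t *\<^sub>R v"
    using independent_common_real_eigenvalue[OF C vw indep line] by blast
  have "v \<noteq> 0"
    using indep[of 1 0] by (auto simp: right_scale_simps)
  have "M *v x = t *\<^sub>R x" if x: "x \<in> C" for x
  proof (cases "\<forall>a b. right_scale x a + right_scale v b = 0 \<longrightarrow> a = 0 \<and> b = 0")
    case True
    then obtain u where "M *v x = u *\<^sub>R x" "M *v v = u *\<^sub>R v"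
      using independent_common_real_eigenvalue[OF C x vw(1) _ line] by blast
    then show ?thesis
      using t \<open>v \<noteq> 0\<close> by simp
  next
    case False
    then obtain a b where ab: "right_scale x a + right_scale v b = 0" "a \<noteq> 0 \<or> b \<noteq> 0"
      by blast
    have "a \<noteq> 0"
    proof
      assume "a = 0"
      then have "right_scale (right_scale v b) (inverse b) = 0"
        using ab by (simp add: right_scale_simps)
      then show False
        using \<open>a = 0\<close> ab(2) \<open>v \<noteq> 0\<close> by (simp add: right_scale_simps(3,4))
    qed
    have "right_scale x a = right_scale v (- b)"
      using ab(1) by (simp add: right_scale_simps eq_neg_iff_add_eq_0)
    then have "right_scale (right_scale x a) (inverse a) = right_scale (right_scale v (- b)) (inverse a)"
      by simp
    then have "x = right_scale v (- b * inverse a)"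
      using \<open>a \<noteq> 0\<close> by (simp add: right_scale_simps(3,4))
    then show ?thesis
      by (metis matrix_vector_right_scale t right_scale_simps(8))
  qed
  then show ?thesis
    by blast
qed

lemma independent_pair_of_right_dim:
  assumes C: "right_submodule C" and dim: "has_right_dim C K" "K \<ge> 2"
  obtains v w where "v \<in> C" "w \<in> C"
    and "\<And>a b. right_scale v a + right_scale w b = 0 \<Longrightarrow> a = 0 \<and> b = 0"
proof -
  obtain B where B: "finite B" "card B = K"
    and indep: "\<And>c. (\<Sum>u\<in>B. right_scale u (c u)) = 0 \<Longrightarrow> \<forall>u\<in>B. c u = 0"
    and C_eq: "C = range (\<lambda>c. \<Sum>u\<in>B. right_scale u (c u))"
    using dim(1) unfolding has_right_dim_def by blast
  from B dim(2) have "\<not> card B \<le> 1"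
    by simp
  then obtain v w where vw: "v \<in> B" "w \<in> B" "v \<noteq> w"
    using card_le_Suc0_iff_eq[OF B(1)] by auto
  have combination: "(\<Sum>u\<in>B. right_scale u (if u = v then a else if u = w then b else 0)) =
      right_scale v a + right_scale w b" for a b
  proof -
    have "(\<Sum>u\<in>B. right_scale u (if u = v then a else if u = w then b else 0)) =
        (\<Sum>u\<in>B. (if u = v then right_scale v a else 0) + (if u = w then right_scale w b else 0))"
      using vw(3) by (intro sum.cong) (auto simp: right_scale_simps)
    then show ?thesis
      using B(1) vw(1,2) by (simp add: sum.distrib)
  qed
  have in_C: "right_scale v a + right_scale w b \<in> C" for a b
    unfolding C_eq combination[symmetric] by (rule rangeI)
  from in_C[of 1 0] in_C[of 0 1] have "v \<in> C" "w \<in> C"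
    by (simp_all add: right_scale_simps)
  moreover have "a = 0 \<and> b = 0" if "right_scale v a + right_scale w b = 0" for a b
    using indep[of "\<lambda>u. if u = v then a else if u = w then b else 0"] that vw
    unfolding combination by auto
  ultimately show ?thesis
    by (rule that)
qed

text \<open>Evaluate the fixed-point equation in a vector \<open>y\<close> orthogonal to \<open>x\<close>. The right side is zero and
  the left side is a sum of squared norms of \<open>qinner y (M l *v x)\<close>, so each \<open>M l *v x\<close> is orthogonal
  to everything orthogonal to \<open>x\<close>. Applied to the component of \<open>M k *v x\<close> orthogonal to \<open>x\<close>, this
  shows that the component is orthogonal to itself.\<close>

lemma kraus_operators_preserve_line:
  assumes "finite I" and k: "k \<in> I"
    and fixed: "kraus_map I M (qouter x x) = qouter x x"
  shows "\<exists>q. M k *v x = right_scale x q"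
proof (cases "x = 0")
  case True
  then show ?thesis
    by (simp add: right_scale_simps)
next
  case False
  define n where "n = (\<Sum>i\<in>UNIV. qnorm2 (x $ i))"
  have n: "qinner x x = n *\<^sub>R 1"
    by (simp add: n_def qinner_self)
  with False have "n \<noteq> 0"
    using qinner_self_eq_0_iff[of x] by auto
  have orthogonal: "qinner y (M k *v x) = 0" if y: "qinner y x = 0" for y
  proof -
    have "(\<Sum>l\<in>I. qnorm2 (qinner y (M l *v x)) *\<^sub>R 1) = qinner y (qouter x x *v y)"
      by (subst fixed[symmetric])
        (simp add: kraus_map_def matrix_mult_qouter sum_matrix_vector qinner_sum_right qinner_qouter_self)
    also have "\<dots> = 0"
      by (simp add: qinner_qouter_self y)
    finally have "(\<Sum>l\<in>I. qnorm2 (qinner y (M l *v x))) *\<^sub>R (1 :: quat) = 0"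
      by (simp add: scaleR_left.sum)
    then have "(\<Sum>l\<in>I. qnorm2 (qinner y (M l *v x))) = 0"
      by simp
    then show ?thesis
      using \<open>finite I\<close> k by (simp add: sum_nonneg_eq_0_iff)
  qed
  define q where "q = (1 / n) *\<^sub>R qinner x (M k *v x)"
  define y where "y = M k *v x - right_scale x q"
  have "qinner x y = 0"
    using \<open>n \<noteq> 0\<close> by (simp add: y_def q_def qinner_diff_right qinner_right_scale n)
  then have yx: "qinner y x = 0"
    using qinner_commute[of x y] by (simp add: qcnj_algebra)
  then have "qinner y (M k *v x) = 0" "qinner y (right_scale x q) = 0"
    using orthogonal by (simp_all add: qinner_right_scale)
  then have "qinner y y = 0"
    by (subst (2) y_def) (simp add: qinner_diff_right)
  then have "y = 0"
    by (simp add: qinner_self_eq_0_iff)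
  then show ?thesis
    by (auto simp: y_def)
qed

lemma kraus_map_scaleR: "kraus_map I A (t *\<^sub>R \<rho>) = t *\<^sub>R kraus_map I A \<rho>"
  by (simp add: kraus_map_def scaleR_matrix_mult_left scaleR_matrix_mult_right scaleR_right.sum)

lemma kraus_map_compose:
  assumes "finite I" "finite J"
  shows "kraus_map I A (kraus_map J E \<rho>) = kraus_map (I \<times> J) (\<lambda>(r, a). A r ** E a) \<rho>"
  by (simp add: kraus_map_def sum_matrix_mult_left sum_matrix_mult_right sum.cartesian_product
      qdagger_mult matrix_mul_assoc case_prod_beta)

lemma pure_state_in_state_space:
  fixes x :: "quat^'n"
  defines "n \<equiv> \<Sum>i\<in>UNIV. qnorm2 (x $ i)"
  assumes "x \<noteq> 0"
  shows "n > 0" and "(1 / n) *\<^sub>R qouter x x \<in> state_space"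
proof -
  have "n \<noteq> 0"
    using assms(2) unfolding n_def by (auto simp: sum_nonneg_eq_0_iff vec_eq_iff)
  then show "n > 0"
    using sum_nonneg[of UNIV "\<lambda>i. qnorm2 (x $ i)"] unfolding n_def by simp
  have "qinner y (((1 / n) *\<^sub>R qouter x x) *v y) \<in> \<real>\<^sub>\<ge>\<^sub>0" for y
  proof -
    have "qinner y (((1 / n) *\<^sub>R qouter x x) *v y) = of_real (qnorm2 (qinner y x) / n)"
      by (simp add: scaleR_matrix_vector qinner_scaleR_right qinner_qouter_self of_real_def)
    then show ?thesis
      using \<open>n > 0\<close> by (simp only: nonneg_Reals_of_real_iff) simp
  qed
  moreover have "qre (trace ((1 / n) *\<^sub>R qouter x x)) = (1 / n) * qre (trace (qouter x x))"
    by (simp add: trace_def quat_component_sum sum_divide_distrib)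
  ultimately show "(1 / n) *\<^sub>R qouter x x \<in> state_space"
    using \<open>n > 0\<close>
    by (simp add: state_space_def qpsd_def qdagger_algebra qdagger_qouter qre_trace_qouter n_def)
qed

text \<open>Compressing the errors and inserting \<open>(\<Sum>l<k. qdagger (A l) ** A l) = mat 1\<close> between
  \<open>qdagger (E a)\<close> and \<open>E b\<close> turns \<open>A l ** E a ** P = m l a *\<^sub>R P\<close> into the real condition with
  \<open>r\<close> the Gram matrix of the columns of \<open>m\<close>, which is why \<open>r\<close> is positive semidefinite.\<close>

lemma real_KL_if_exactly_correctable:
  fixes C :: "(quat^'n) set" and P :: "quat^'n^'n" and E :: "'m::finite \<Rightarrow> quat^'n^'n"
  assumes C: "right_submodule C" and dim: "has_right_dim C K" "K \<ge> 2"
    and proj: "orth_projector P C"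
    and corr: "exactly_correctable P E"
  shows "\<exists>r. real_KL P E r"
proof -
  have P: "qdagger P = P" "P ** P = P" "range ((*v) P) = C"
    using proj by (auto simp: orth_projector_def)
  have Px: "P *v x = x" if "x \<in> C" for x
    using that P(2) unfolding P(3)[symmetric] by (auto simp: matrix_vector_mul_assoc)
  obtain R where R: "quat_channel R"
    and recovers: "\<And>\<rho>. \<rho> \<in> state_space \<Longrightarrow> P ** \<rho> ** P = \<rho> \<Longrightarrow> R (kraus_map UNIV E \<rho>) = \<rho>"
    using corr unfolding exactly_correctable_def by blast
  obtain k :: nat and A where R_eq: "R = kraus_map {..<k} A"
    and complete: "(\<Sum>l<k. qdagger (A l) ** A l) = mat 1"
    using R unfolding quat_channel_def by blast
  define M where "M = (\<lambda>(l, a). A l ** E a)"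
  have fixed: "kraus_map ({..<k} \<times> UNIV) M (qouter x x) = qouter x x" if x: "x \<in> C" for x
  proof (cases "x = 0")
    case True
    then have "qouter x x = 0 *\<^sub>R qouter x x"
      by (simp add: qouter_def vec_eq_iff)
    then show ?thesis
      by (metis kraus_map_scaleR scaleR_zero_left)
  next
    case False
    let ?n = "\<Sum>i\<in>UNIV. qnorm2 (x $ i)"
    let ?\<rho> = "(1 / ?n) *\<^sub>R qouter x x"
    have "P ** qouter x x ** P = qouter x x"
      using matrix_mult_qouter[of P x x P] by (simp add: P Px x)
    then have "P ** ?\<rho> ** P = ?\<rho>"
      by (simp add: scaleR_matrix_mult_left scaleR_matrix_mult_right)
    then have "kraus_map ({..<k} \<times> UNIV) M ?\<rho> = ?\<rho>"
      using recovers[OF pure_state_in_state_space(2)[OF False]]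
      by (simp add: R_eq kraus_map_compose M_def)
    then show ?thesis
      using pure_state_in_state_space(1)[OF False] unfolding kraus_map_scaleR by simp
  qed
  obtain v w where vw: "v \<in> C" "w \<in> C"
    and indep: "\<And>a b. right_scale v a + right_scale w b = 0 \<Longrightarrow> a = 0 \<and> b = 0"
    using independent_pair_of_right_dim[OF C dim] by metis
  have "\<exists>t. M (l, a) ** P = t *\<^sub>R P" if "l < k" for l a
  proof -
    have "\<exists>q. M (l, a) *v x = right_scale x q" if "x \<in> C" for x
      using kraus_operators_preserve_line[OF _ _ fixed[OF that]] \<open>l < k\<close> by simp
    then obtain t where t: "\<And>x. x \<in> C \<Longrightarrow> M (l, a) *v x = t *\<^sub>R x"
      using real_scalar_on_submodule[OF C vw indep] by meson
    have "(M (l, a) ** P) *v x = (t *\<^sub>R P) *v x" for x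
      using t[of "P *v x"] P(3) by (auto simp: matrix_vector_mul_assoc scaleR_matrix_vector)
    then show ?thesis
      by (blast intro: matrix_eqI_vector)
  qed
  then obtain m where m: "\<And>l a. l < k \<Longrightarrow> A l ** E a ** P = m l a *\<^sub>R P"
    unfolding M_def by (metis case_prod_conv)
  define r :: "real^'m^'m" where "r = (\<chi> a b. \<Sum>l<k. m l a * m l b)"
  have "P ** qdagger (E a) ** E b ** P = r $ a $ b *\<^sub>R P" for a b
  proof -
    have "P ** qdagger (E a) ** E b ** P =
        P ** qdagger (E a) ** (\<Sum>l<k. qdagger (A l) ** A l) ** E b ** P"
      by (simp add: complete)
    also have "\<dots> = (\<Sum>l<k. qdagger (A l ** E a ** P) ** (A l ** E b ** P))"
      by (simp add: sum_matrix_mult_left sum_matrix_mult_right matrix_mul_assoc qdagger_mult P)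
    also have "\<dots> = (\<Sum>l<k. (m l a * m l b) *\<^sub>R P)"
      by (intro sum.cong)
        (auto simp: m qdagger_algebra P scaleR_matrix_mult_left scaleR_matrix_mult_right mult.commute)
    finally show ?thesis
      by (simp add: r_def scaleR_left.sum)
  qed
  moreover have "real_psd r"
  proof -
    have "x \<bullet> (r *v x) = (\<Sum>l<k. (\<Sum>a\<in>UNIV. m l a * x $ a)\<^sup>2)" for x
    proof -
      have "x \<bullet> (r *v x) = (\<Sum>a\<in>UNIV. \<Sum>b\<in>UNIV. \<Sum>l<k. (m l a * x $ a) * (m l b * x $ b))"
        by (simp add: inner_vec_def matrix_vector_mult_def r_def sum_distrib_left sum_distrib_right
            mult_ac)
      also have "\<dots> = (\<Sum>a\<in>UNIV. \<Sum>l<k. \<Sum>b\<in>UNIV. (m l a * x $ a) * (m l b * x $ b))"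
        by (intro sum.cong refl sum.swap)
      also have "\<dots> = (\<Sum>l<k. \<Sum>a\<in>UNIV. \<Sum>b\<in>UNIV. (m l a * x $ a) * (m l b * x $ b))"
        by (rule sum.swap)
      finally show ?thesis
        by (simp add: power2_eq_square sum_product)
    qed
    moreover have "transpose r = r"
      by (simp add: r_def transpose_def vec_eq_iff mult.commute)
    ultimately show ?thesis
      by (simp add: real_psd_def sum_nonneg)
  qed
  ultimately show ?thesis
    unfolding real_KL_def by blast
qed

section \<open>The complex representation\<close>

lemma sum_UNIV_Plus: "(\<Sum>s\<in>(UNIV :: ('a::finite + 'b::finite) set). f s) =
    (\<Sum>a\<in>UNIV. f (Inl a)) + (\<Sum>b\<in>UNIV. f (Inr b))"
  unfolding UNIV_Plus_UNIV[symmetric] by (subst sum.Plus) simp_all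

lemma chi_nth:
  "chi A $ Inl a $ Inl b = complex_part (A $ a $ b)"
  "chi A $ Inl a $ Inr b = j_part (A $ a $ b)"
  "chi A $ Inr a $ Inl b = - cnj (j_part (A $ a $ b))"
  "chi A $ Inr a $ Inr b = cnj (complex_part (A $ a $ b))"
  by (simp_all add: chi_def)

lemma complex_parts_sum:
  "complex_part (\<Sum>a\<in>S. f a) = (\<Sum>a\<in>S. complex_part (f a))"
  "j_part (\<Sum>a\<in>S. f a) = (\<Sum>a\<in>S. j_part (f a))"
  by (simp_all add: complex_eq_iff complex_part_def j_part_def quat_component_sum)

lemma complex_parts_mult:
  "complex_part (p * q) = complex_part p * complex_part q - j_part p * cnj (j_part q)"
  "j_part (p * q) = complex_part p * j_part q + j_part p * cnj (complex_part q)"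
  by (simp_all add: complex_eq_iff complex_part_def j_part_def times_quat_def)

lemma complex_parts_scaleR:
  "complex_part (t *\<^sub>R q) = of_real t * complex_part q"
  "j_part (t *\<^sub>R q) = of_real t * j_part q"
  by (simp_all add: complex_eq_iff complex_part_def j_part_def)

lemma complex_parts_qcnj:
  "complex_part (qcnj q) = cnj (complex_part q)" "j_part (qcnj q) = - j_part q"
  by (simp_all add: complex_eq_iff complex_part_def j_part_def)

lemma quat_eqI_complex_parts:
  "complex_part p = complex_part q \<Longrightarrow> j_part p = j_part q \<Longrightarrow> p = q"
  by (simp add: quat_eq_iff complex_eq_iff complex_part_def j_part_def)

lemma matrix_eqI_blocks:
  fixes A B :: "'c^('n::finite + 'n)^('n + 'n)"
  assumes "\<And>a b. A $ Inl a $ Inl b = B $ Inl a $ Inl b" "\<And>a b. A $ Inl a $ Inr b = B $ Inl a $ Inr b"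
    and "\<And>a b. A $ Inr a $ Inl b = B $ Inr a $ Inl b" "\<And>a b. A $ Inr a $ Inr b = B $ Inr a $ Inr b"
  shows "A = B"
  unfolding vec_eq_iff by (metis assms sum.exhaust)

lemma chi_mult: "chi (A ** B) = chi A ** chi B"
  by (rule matrix_eqI_blocks)
    (simp_all add: chi_nth matrix_matrix_mult_def sum_UNIV_Plus complex_parts_sum complex_parts_mult
      sum.distrib sum_subtractf sum_negf algebra_simps)

lemma cdagger_nth: "cdagger A $ s $ t = cnj (A $ t $ s)"
  by (simp add: cdagger_def map_matrix_def transpose_def)

lemma chi_qdagger: "chi (qdagger A) = cdagger (chi A)"
  by (rule matrix_eqI_blocks) (simp_all add: chi_nth cdagger_nth complex_parts_qcnj)

lemma chi_scaleR: "chi (t *\<^sub>R A) = map_matrix ((*) (of_real t)) (chi A)"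
  by (rule matrix_eqI_blocks) (simp_all add: chi_nth map_matrix_def complex_parts_scaleR)

text \<open>The upper blocks of the equation give each complex part of \<open>A\<close> as \<open>z\<close> times that of \<open>P\<close>; the
  lower blocks, after conjugation, give the same with \<open>cnj z\<close>. A nonzero entry of \<open>P\<close> then forces
  \<open>z = cnj z\<close>.\<close>

lemma chi_real_multiple:
  assumes eq: "chi A = map_matrix ((*) z) (chi P)" and "P \<noteq> 0"
  shows "A = Re z *\<^sub>R P"
proof -
  have c: "complex_part (A $ a $ b) = z * complex_part (P $ a $ b)"
    "complex_part (A $ a $ b) = cnj z * complex_part (P $ a $ b)"
    and j: "j_part (A $ a $ b) = z * j_part (P $ a $ b)"
    "j_part (A $ a $ b) = cnj z * j_part (P $ a $ b)" for a b
    using arg_cong[OF eq, of "\<lambda>X. X $ Inl a $ Inl b"] arg_cong[OF eq, of "\<lambda>X. X $ Inl a $ Inr b"]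
      arg_cong[OF eq, of "\<lambda>X. cnj (X $ Inr a $ Inl b)"]
      arg_cong[OF eq, of "\<lambda>X. cnj (X $ Inr a $ Inr b)"]
    by (simp_all add: chi_nth map_matrix_def)
  obtain a b where "P $ a $ b \<noteq> 0"
    using \<open>P \<noteq> 0\<close> by (auto simp: vec_eq_iff)
  then have "complex_part (P $ a $ b) \<noteq> 0 \<or> j_part (P $ a $ b) \<noteq> 0"
    by (auto simp: quat_eq_iff complex_part_def j_part_def complex_eq_iff)
  then have "cnj z = z"
    using c[of a b] j[of a b] by auto
  then have "of_real (Re z) = z"
    by (metis Reals_cnj_iff of_real_Re)
  then show ?thesis
    unfolding vec_eq_iff
    by (auto intro!: quat_eqI_complex_parts simp: complex_parts_scaleR c(1) j(1))
qed

text \<open>For \<open>x = u + i v\<close> with real \<open>u\<close> and \<open>v\<close>, the Hermitian form of \<open>x\<close> is the real form of \<open>u\<close> plus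
  that of \<open>v\<close>; the mixed terms cancel by symmetry of \<open>r\<close>.\<close>

lemma cpsd_of_real:
  fixes r :: "real^'m^'m"
  assumes "real_psd r"
  shows "cpsd (map_matrix of_real r)"
proof -
  have sym: "r $ a $ b = r $ b $ a" for a b
  proof -
    have "r $ a $ b = transpose r $ b $ a"
      by (simp add: transpose_def)
    then show ?thesis
      using assms by (simp add: real_psd_def)
  qed
  have form: "(\<Sum>a\<in>UNIV. cnj (x $ a) * (map_matrix of_real r *v x) $ a) \<in> \<real>\<^sub>\<ge>\<^sub>0" for x :: "complex^'m"
  proof -
    define u v :: "real^'m" where "u = (\<chi> a. Re (x $ a))" and "v = (\<chi> a. Im (x $ a))"
    let ?S = "\<Sum>a\<in>UNIV. cnj (x $ a) * (map_matrix of_real r *v x) $ a"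
    have "Re ?S = u \<bullet> (r *v u) + v \<bullet> (r *v v)"
      by (simp add: u_def v_def inner_vec_def matrix_vector_mult_def map_matrix_def sum.distrib)
    moreover have "Im ?S = u \<bullet> (r *v v) - v \<bullet> (r *v u)"
      by (simp add: u_def v_def inner_vec_def matrix_vector_mult_def map_matrix_def sum_subtractf)
    moreover have "v \<bullet> (r *v u) = u \<bullet> (r *v v)"
      using assms by (metis dot_lmul_matrix inner_commute real_psd_def vector_transpose_matrix)
    ultimately show ?thesis
      using assms by (simp add: complex_nonneg_Reals_iff real_psd_def)
  qed
  show ?thesis
    unfolding cpsd_def using form
    by (auto simp: vec_eq_iff cdagger_nth map_matrix_def sym)
qed

lemma real_psd_Re:
  fixes l :: "complex^'m^'m"
  assumes "cpsd l"
  shows "real_psd (map_matrix Re l)"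
proof -
  have "cnj (l $ b $ a) = l $ a $ b" for a b
    using assms by (metis cdagger_nth cpsd_def)
  then have "transpose (map_matrix Re l) = map_matrix Re l"
    by (simp add: vec_eq_iff transpose_def map_matrix_def) (metis complex_cnj(1) complex.sel(1) complex.collapse)
  moreover have "0 \<le> x \<bullet> (map_matrix Re l *v x)" for x
  proof -
    define z :: "complex^'m" where "z = (\<chi> a. of_real (x $ a))"
    have "0 \<le> Re (\<Sum>a\<in>UNIV. cnj (z $ a) * (l *v z) $ a)"
      using assms by (auto simp: cpsd_def complex_nonneg_Reals_iff)
    then show ?thesis
      by (simp add: z_def inner_vec_def matrix_vector_mult_def map_matrix_def)
  qed
  ultimately show ?thesis
    by (simp add: real_psd_def)
qed

lemma real_KL_iff_complex_KL:
  assumes "P \<noteq> 0" and P: "qdagger P = P"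
  shows "(\<exists>r. real_KL P E r) \<longleftrightarrow> (\<exists>l. complex_KL (chi P) (\<lambda>a. chi (E a)) l)"
proof
  have rep: "chi P ** cdagger (chi (E a)) ** chi (E b) ** chi P =
      chi (P ** qdagger (E a) ** E b ** P)" for a b
    by (simp add: chi_mult chi_qdagger)
  {
    assume "\<exists>r. real_KL P E r"
    then obtain r where "real_KL P E r" ..
    then have "complex_KL (chi P) (\<lambda>a. chi (E a)) (map_matrix of_real r)"
      unfolding complex_KL_def real_KL_def rep using cpsd_of_real[of r]
      by (simp add: chi_scaleR)
    then show "\<exists>l. complex_KL (chi P) (\<lambda>a. chi (E a)) l" ..
  next
    assume "\<exists>l. complex_KL (chi P) (\<lambda>a. chi (E a)) l"
    then obtain l where l: "cpsd l"
      and "\<And>a b. chi (P ** qdagger (E a) ** E b ** P) = map_matrix ((*) (l $ a $ b)) (chi P)"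
      unfolding complex_KL_def rep by blast
    then have "P ** qdagger (E a) ** E b ** P = Re (l $ a $ b) *\<^sub>R P" for a b
      using chi_real_multiple[OF _ \<open>P \<noteq> 0\<close>] by blast
    then have "real_KL P E (map_matrix Re l)"
      unfolding real_KL_def using real_psd_Re[OF l] by (simp add: map_matrix_def)
    then show "\<exists>r. real_KL P E r" ..
  }
qed

section \<open>Syndrome directions\<close>

lemma diag_matrix_mult_vector: "(diag_matrix d *v x) $ i = d $ i * x $ i"
proof -
  have "(\<Sum>j\<in>UNIV. (if i = j then d $ i else 0) * x $ j) =
      (\<Sum>j\<in>UNIV. if i = j then d $ i * x $ i else 0)"
    by (intro sum.cong) auto
  then show ?thesis
    by (simp add: diag_matrix_def matrix_vector_mult_def)
qed

lemma rank_diag_matrix: "rank (diag_matrix d) = card {i. d $ i \<noteq> 0}" for d :: "real^'m"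
proof -
  have "range ((*v) (diag_matrix d)) = {x. \<forall>i. i \<notin> {i. d $ i \<noteq> 0} \<longrightarrow> x $ i = 0}"
  proof (intro equalityI subsetI)
    fix x :: "real^'m"
    assume x: "x \<in> {x. \<forall>i. i \<notin> {i. d $ i \<noteq> 0} \<longrightarrow> x $ i = 0}"
    have "x = diag_matrix d *v (\<chi> i. x $ i / d $ i)"
      using x by (simp add: vec_eq_iff diag_matrix_mult_vector)
    then show "x \<in> range ((*v) (diag_matrix d))"
      by blast
  qed (auto simp: diag_matrix_mult_vector)
  then show ?thesis
    using dim_substandard_cart[where 'a = real, of "{i. d $ i \<noteq> 0}"]
    by (simp add: rank_dim_range dim_vec_eq)
qed

text \<open>Multiplication never increases rank, and conjugation by \<open>U\<close> is undone by conjugation with its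
  transpose.\<close>

lemma rank_orthogonal_conjugate:
  fixes U r :: "real^'n^'n"
  assumes "orthogonal_matrix U"
  shows "rank (U ** r ** transpose U) = rank r"
proof (rule antisym)
  show "rank (U ** r ** transpose U) \<le> rank r"
    using rank_mul_le_left[of "U ** r" "transpose U"] rank_mul_le_right[of U r] by linarith
  have "transpose U ** (U ** r ** transpose U) ** U = (transpose U ** U) ** r ** (transpose U ** U)"
    by (simp only: matrix_mul_assoc)
  also have "\<dots> = r"
    using assms by (simp add: orthogonal_matrix_def)
  finally show "rank r \<le> rank (U ** r ** transpose U)"
    using rank_mul_le_left[of "transpose U ** (U ** r ** transpose U)" U]
      rank_mul_le_right[of "transpose U" "U ** r ** transpose U"] by simp
qed

text \<open>Each diagonal entry is the value of the form of \<open>r\<close> at a row of \<open>U\<close>.\<close>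

lemma diagonalizes_nonneg:
  assumes "real_psd r" and "diagonalizes U r d"
  shows "0 \<le> d $ \<mu>"
proof -
  let ?e = "axis \<mu> 1"
  have "d $ \<mu> = ?e \<bullet> (diag_matrix d *v ?e)"
    by (simp add: inner_axis' matrix_vector_mult_basis column_def diag_matrix_def)
  also have "\<dots> = ?e \<bullet> (U *v (r *v (transpose U *v ?e)))"
    using assms(2)
    by (simp add: diagonalizes_def matrix_vector_mul_assoc matrix_mul_assoc del: transpose_matrix_vector)
  also have "\<dots> = (transpose U *v ?e) \<bullet> (r *v (transpose U *v ?e))"
    by (simp add: dot_lmul_matrix)
  finally show ?thesis
    using assms(1) by (simp add: real_psd_def)
qed

lemma rank_eq_card_syndrome_directions:
  assumes "real_psd r" and "diagonalizes U r d"
  shows "rank r = card (syndrome_directions d)"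
proof -
  have "rank r = rank (diag_matrix d)"
    using assms(2) rank_orthogonal_conjugate[of U r] by (simp add: diagonalizes_def)
  also have "\<dots> = card (syndrome_directions d)"
    using diagonalizes_nonneg[OF assms]
    by (simp add: rank_diag_matrix syndrome_directions_def less_le)
  finally show ?thesis .
qed

text \<open>Expanding \<open>syndrome_F\<close> in the errors gives the \<open>\<mu>\<close>-th diagonal entry of
  \<open>U ** r ** transpose U\<close> times \<open>P\<close>; the normalisation by \<open>sqrt (d $ \<mu>)\<close> removes the entry.\<close>

lemma syndrome_V_isometry:
  assumes P: "qdagger P = P" and KL: "real_KL P E r" and U: "diagonalizes U r d"
    and \<mu>: "\<mu> \<in> syndrome_directions d"
  shows "qdagger (syndrome_V P E U d \<mu>) ** syndrome_V P E U d \<mu> = P"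
proof -
  let ?F = "syndrome_F E U \<mu>"
  have KL: "P ** qdagger (E a) ** E b ** P = r $ a $ b *\<^sub>R P" for a b
    using KL by (simp add: real_KL_def)
  have "qdagger (?F ** P) ** (?F ** P) =
      (\<Sum>b\<in>UNIV. \<Sum>a\<in>UNIV. (U $ \<mu> $ b * U $ \<mu> $ a) *\<^sub>R (P ** qdagger (E a) ** E b ** P))"
    by (simp add: syndrome_F_def qdagger_mult P qdagger_sum qdagger_algebra sum_matrix_mult_left
        sum_matrix_mult_right scaleR_matrix_mult_left scaleR_matrix_mult_right matrix_mul_assoc
        scaleR_right.sum)
  also have "\<dots> = (\<Sum>b\<in>UNIV. \<Sum>a\<in>UNIV. U $ \<mu> $ b * U $ \<mu> $ a * r $ a $ b) *\<^sub>R P"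
    by (simp add: KL scaleR_left.sum)
  also have "(\<Sum>b\<in>UNIV. \<Sum>a\<in>UNIV. U $ \<mu> $ b * U $ \<mu> $ a * r $ a $ b) =
      (U ** r ** transpose U) $ \<mu> $ \<mu>"
    by (simp add: matrix_matrix_mult_def transpose_def sum_distrib_left sum_distrib_right mult_ac)
  also have "\<dots> = d $ \<mu>"
    using U by (simp add: diagonalizes_def diag_matrix_def)
  finally show ?thesis
    using \<mu> by (simp add: syndrome_V_def syndrome_directions_def qdagger_algebra
        scaleR_matrix_mult_left scaleR_matrix_mult_right)
qed

lemma isometry_range_projector:
  fixes V P :: "quat^'n^'n"
  assumes P: "P \<noteq> 0" "P ** P = P" and VV: "qdagger V ** V = P" and VP: "V ** P = V"
  shows "range ((*v) (V ** qdagger V)) \<noteq> {0}"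
    and "orth_projector (V ** qdagger V) (range ((*v) (V ** qdagger V)))"
proof -
  show "range ((*v) (V ** qdagger V)) \<noteq> {0}"
  proof
    assume "range ((*v) (V ** qdagger V)) = {0}"
    then have "(V ** qdagger V) *v x = 0 *v x" for x
      by auto
    then have "V ** qdagger V = 0"
      by (rule matrix_eqI_vector)
    then have "(qdagger V ** V) ** (qdagger V ** V) = 0"
      by (metis matrix_mul_assoc matrix_mult_zero)
    then show False
      using P by (simp add: VV)
  qed
  have "V ** qdagger V ** (V ** qdagger V) = V ** (qdagger V ** V) ** qdagger V"
    by (simp only: matrix_mul_assoc)
  then show "orth_projector (V ** qdagger V) (range ((*v) (V ** qdagger V)))"
    by (simp add: orth_projector_def qdagger_mult qdagger_algebra VV VP)
qed

lemma real_KL_unique: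
  assumes "P \<noteq> 0" and "real_KL P E r" and "real_KL P E r'"
  shows "r = r'"
proof -
  have "r $ a $ b *\<^sub>R P = r' $ a $ b *\<^sub>R P" for a b
    using assms(2,3) unfolding real_KL_def by metis
  then have "r $ a $ b = r' $ a $ b" for a b
    using \<open>P \<noteq> 0\<close> by (metis scaleR_cancel_right)
  then show ?thesis
    by (simp add: vec_eq_iff)
qed

lemma trace_real_KL:
  assumes P: "P \<noteq> 0" "P ** P = P" and E: "(\<Sum>a\<in>UNIV. qdagger (E a) ** E a) = mat 1"
    and KL: "real_KL P E r"
  shows "trace r = 1"
proof -
  have "trace r *\<^sub>R P = (\<Sum>a\<in>UNIV. P ** qdagger (E a) ** E a ** P)"
    using KL by (simp add: real_KL_def trace_def scaleR_left.sum)
  also have "\<dots> = P ** (\<Sum>a\<in>UNIV. qdagger (E a) ** E a) ** P"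
    by (simp add: sum_matrix_mult_left sum_matrix_mult_right matrix_mul_assoc)
  also have "\<dots> = 1 *\<^sub>R P"
    by (simp add: E P)
  finally show ?thesis
    using P(1) by (simp only: scaleR_cancel_right) simp
qed

theorem theorem10:
  fixes C :: "(quat^'n) set" and K :: nat
    and P :: "quat^'n^'n" and E :: "'m::finite \<Rightarrow> quat^'n^'n"
  assumes "right_submodule C"
    and "has_right_dim C K" and "K \<ge> 2"
    and "orth_projector P C"
    and "(\<Sum>a\<in>UNIV. qdagger (E a) ** E a) = mat 1"
  shows "(exactly_correctable P E \<longleftrightarrow> (\<exists>r. real_KL P E r)) \<and>
    ((\<exists>r. real_KL P E r) \<longleftrightarrow> (\<exists>l. complex_KL (chi P) (\<lambda>a. chi (E a)) l)) \<and>
    (exactly_correctable P E \<longrightarrow>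
      (\<exists>!r. real_KL P E r) \<and>
      (\<forall>r. real_KL P E r \<longrightarrow>
        transpose r = r \<and> trace r = 1 \<and>
        (\<forall>U d. diagonalizes U r d \<longrightarrow>
          rank r = card (syndrome_directions d) \<and>
          (\<forall>\<mu>\<in>syndrome_directions d.
            syndrome_sector P E U d \<mu> \<noteq> {0} \<and>
            orth_projector (syndrome_Q P E U d \<mu>) (syndrome_sector P E U d \<mu>)))))"
proof (intro conjI)
  have P: "qdagger P = P" "P ** P = P" and range_P: "range ((*v) P) = C"
    using assms(4) by (simp_all add: orth_projector_def)
  \<comment> \<open>A code of dimension at least two is not the zero submodule.\<close>
  have "P \<noteq> 0"
  proof
    assume "P = 0"
    then have "C = {0}"
      using range_P by auto
    moreover obtain v w where "v \<in> C" "w \<in> C"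
      and "\<And>a b. right_scale v a + right_scale w b = 0 \<Longrightarrow> a = 0 \<and> b = 0"
      using independent_pair_of_right_dim[OF assms(1-3)] by metis
    ultimately show False
      by (metis add.right_neutral right_scale_simps(6) singletonD zero_neq_one)
  qed
  show correctable: "exactly_correctable P E \<longleftrightarrow> (\<exists>r. real_KL P E r)"
  proof
    show "\<exists>r. real_KL P E r" if "exactly_correctable P E"
      using real_KL_if_exactly_correctable[OF assms(1-4) that] .
    show "exactly_correctable P E" if "\<exists>r. real_KL P E r"
    proof -
      from that obtain r where "\<And>a b. P ** qdagger (E a) ** E b ** P = r $ a $ b *\<^sub>R P"
        by (auto simp: real_KL_def)
      then show ?thesis
        by (rule exactly_correctable_if_real_KL[OF P assms(5)])
    qed
  qed
  show "(\<exists>r. real_KL P E r) \<longleftrightarrow> (\<exists>l. complex_KL (chi P) (\<lambda>a. chi (E a)) l)"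
    using real_KL_iff_complex_KL[OF \<open>P \<noteq> 0\<close> P(1)] .
  have syndrome: "syndrome_sector P E U d \<mu> \<noteq> {0} \<and>
      orth_projector (syndrome_Q P E U d \<mu>) (syndrome_sector P E U d \<mu>)"
    if "real_KL P E r" "diagonalizes U r d" "\<mu> \<in> syndrome_directions d" for r U d \<mu>
  proof -
    have "syndrome_V P E U d \<mu> ** P = syndrome_V P E U d \<mu>"
      by (simp add: syndrome_V_def scaleR_matrix_mult_left matrix_mul_assoc[symmetric] P)
    from isometry_range_projector[OF \<open>P \<noteq> 0\<close> P(2) syndrome_V_isometry[OF P(1) that] this]
    show ?thesis
      by (simp add: syndrome_sector_def syndrome_Q_def)
  qed
  show "exactly_correctable P E \<longrightarrow>
      (\<exists>!r. real_KL P E r) \<and>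
      (\<forall>r. real_KL P E r \<longrightarrow>
        transpose r = r \<and> trace r = 1 \<and>
        (\<forall>U d. diagonalizes U r d \<longrightarrow>
          rank r = card (syndrome_directions d) \<and>
          (\<forall>\<mu>\<in>syndrome_directions d.
            syndrome_sector P E U d \<mu> \<noteq> {0} \<and>
            orth_projector (syndrome_Q P E U d \<mu>) (syndrome_sector P E U d \<mu>))))"
  proof (intro impI conjI allI ballI)
    show "\<exists>!r. real_KL P E r" if "exactly_correctable P E"
      using that correctable real_KL_unique[OF \<open>P \<noteq> 0\<close>] by blast
  next
    fix r
    assume KL: "real_KL P E r"
    then have psd: "real_psd r"
      by (simp add: real_KL_def)
    then show "transpose r = r"
      by (simp add: real_psd_def)
    show "trace r = 1"
      using trace_real_KL[OF \<open>P \<noteq> 0\<close> P(2) assms(5) KL] .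
    fix U d
    assume U: "diagonalizes U r d"
    show "rank r = card (syndrome_directions d)"
      using rank_eq_card_syndrome_directions[OF psd U] .
    fix \<mu>
    assume "\<mu> \<in> syndrome_directions d"
    from syndrome[OF KL U this]
    show "syndrome_sector P E U d \<mu> \<noteq> {0}"
      and "orth_projector (syndrome_Q P E U d \<mu>) (syndrome_sector P E U d \<mu>)"
      by blast+
  qed
qed

end
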